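(* Let $X$ be a real Hilbert space with inner product $(\cdot,\cdot)_X$, norm $\|\cdot\|_X$, dual space $X^\star$ and duality pairing $\langle\cdot,\cdot\rangle$ on $X^\star\times X$. Let $\mathsf{H}:X\to\mathbb{R}$ be a functional with Gateaux derivative $\mathsf{F}:=\mathsf{H}':X\to X^\star$, satisfying the standing assumptions listed in the context. Suppose that one of the following is given. (i) A family $(\mathsf{P}[u])_{u\in X}$ of linear and invertible operators $\mathsf{P}[u]:X\to X^\star$ such that the induced bilinear forms $a_u=a(u;\cdot,\cdot):X\times X\to\mathbb{R}$, defined by $a(u;v,w):=\langle \mathsf{P}[u]v,w\rangle$ for $u,v,w\in X$, satisfy (A1)–(A3) below. (ii) (Vice versa) A family $(a_u)_{u\in X}$ of bilinear forms $a_u=a(u;\cdot,\cdot):X\times X\to\mathbb{R}$ satisfying (A1)–(A3) below, with the (then linear and invertible) operators $\mathsf{P}[u]:X\to X^\star$ defined by $\langle \mathsf{P}[u]v,w\rangle:=a(u;v,w)$ for $u,v,w\in X$. The conditions are: (A1) there is a constant $\alpha>0$ such that $a(u;v,v)\ge \alpha\|v\|_X^2$ for all $u,v\in X$; (A2) there is a constant $\beta>0$ such that $a(u;v,w)\le \beta\|v\|_X\|w\|_X$ for all $u,v,w\in X$; (A3) $a(u;v,w)=a(u;w,v)$ for all $u,v,w\in X$. Then the fixed-point iteration with preconditioner $\mathsf{P}[u]$, $$u^{n+1}=u^n-\mathsf{P}[u^n]^{-1}\mathsf{F}(u^n),\qquad n=0,1,2,\dotsc,$$ coincides with the steepest descent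 method $$u^{n+1}=u^n-\delta^n\,\nabla_{a_{u^n}}\mathsf{H}(u^n),\qquad n=0,1,2,\dotsc,$$ in which the gradient at $u^n$ is taken with respect to the (changing) inner product $a_{u^n}(\cdot,\cdot)$ and the step sizes satisfy $\delta^n=1$ for all $n=0,1,2,\dotsc$. That is, for any initial guess $u^0\in X$ the two iterations generate the same sequence.
   Context: Standing assumptions of the paper on $\mathsf{H}$: $\mathsf{H}$ is Gateaux-differentiable, strictly convex, and weakly coercive (i.e. $\mathsf{H}(u)\to\infty$ as $\|u\|_X\to\infty$). Standing assumptions on $\mathsf{F}=\mathsf{H}'$: $\mathsf{F}$ is strongly monotone, i.e. there is $\nu>0$ with $\langle \mathsf{F}(u)-\mathsf{F}(v),u-v\rangle\ge\nu\|u-v\|_X^2$ for all $u,v\in X$; and Lipschitz continuous, i.e. there is $L_{\mathsf{F}}>0$ with $\langle \mathsf{F}(u)-\mathsf{F}(v),w\rangle\le L_{\mathsf{F}}\|u-v\|_X\|w\|_X$ for all $u,v,w\in X$. $X^\star$ denotes the set of all continuous linear functionals from $X$ to $\mathbb{R}$. Gradient with respect to the changing inner product: for fixed $u\in X$, conditions (A1)–(A3) make $a_u(\cdot,\cdot)$ an inner product on $X$ whose norm is equivalent to $\|\cdot\|_X$. The gradient $\nabla_{a_u}\mathsf{H}(u)\in X$ of $\mathsf{H}$ at $u$ with respect to $a_u$ is defined as the unique element of $X$ satisfying $$a_u(\nabla_{a_u}\mathsf{H}(u),v)=\langle \mathsf{H}'(u),v\rangle=\langle\mathsf{F}(u),v\rangle\qquad\text{for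 all } v\in X.$$ Steepest descent method: the iteration $u^{n+1}:=u^n-\delta^n\nabla\mathsf{H}(u^n)$ with step sizes $\delta^n>0$, where $\nabla\mathsf{H}(u^n)$ is the gradient with respect to the chosen inner product. *)

theory Defs
  imports "HOL-Analysis.Analysis"
begin

text \<open>
  The dual of a real Hilbert space \<open>'a\<close> is the type \<open>'a \<Rightarrow>\<^sub>L real\<close>, and the duality pairing of
  \<open>f\<close> with \<open>v\<close> is \<open>blinfun_apply f v\<close>.
\<close>

definition has_gateaux_derivative ::
    "('a::real_normed_vector \<Rightarrow> real) \<Rightarrow> ('a \<Rightarrow>\<^sub>L real) \<Rightarrow> 'a \<Rightarrow> bool" where
  "has_gateaux_derivative H L u \<longleftrightarrow>
     (\<forall>v. ((\<lambda>t::real. (H (u + t *\<^sub>R v) - H u) / t) \<longlongrightarrow> blinfun_apply L v) (at 0))"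

definition gateaux_differentiable :: "('a::real_normed_vector \<Rightarrow> real) \<Rightarrow> bool" where
  "gateaux_differentiable H \<longleftrightarrow> (\<forall>u. \<exists>L. has_gateaux_derivative H L u)"

definition gateaux_deriv :: "('a::real_normed_vector \<Rightarrow> real) \<Rightarrow> 'a \<Rightarrow> 'a \<Rightarrow>\<^sub>L real" where
  "gateaux_deriv H u = (THE L. has_gateaux_derivative H L u)"

lemma has_gateaux_derivative_unique:
  assumes "has_gateaux_derivative H L u" "has_gateaux_derivative H M u"
  shows "L = M"
proof (rule blinfun_eqI)
  fix v
  show "blinfun_apply L v = blinfun_apply M v"
    using assms unfolding has_gateaux_derivative_def
    by (meson tendsto_unique trivial_limit_at)
qed

lemma gateaux_deriv_eq: "has_gateaux_derivative H L u \<Longrightarrow> gateaux_deriv H u = L"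
  unfolding gateaux_deriv_def by (blast intro: the_equality has_gateaux_derivative_unique)

definition strictly_convex :: "('a::real_vector \<Rightarrow> real) \<Rightarrow> bool" where
  "strictly_convex H \<longleftrightarrow>
     (\<forall>u v t. u \<noteq> v \<longrightarrow> 0 < t \<longrightarrow> t < 1 \<longrightarrow>
        H ((1 - t) *\<^sub>R u + t *\<^sub>R v) < (1 - t) * H u + t * H v)"

definition weakly_coercive :: "('a::real_normed_vector \<Rightarrow> real) \<Rightarrow> bool" where
  "weakly_coercive H \<longleftrightarrow> filterlim H at_top at_infinity"

definition strongly_monotone :: "('a::real_normed_vector \<Rightarrow> 'a \<Rightarrow>\<^sub>L real) \<Rightarrow> bool" where
  "strongly_monotone F \<longleftrightarrow>
     (\<exists>\<nu>>0. \<forall>u v. blinfun_apply (F u - F v) (u - v) \<ge> \<nu> * (norm (u - v))\<^sup>2)"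

definition lipschitz_operator :: "('a::real_normed_vector \<Rightarrow> 'a \<Rightarrow>\<^sub>L real) \<Rightarrow> bool" where
  "lipschitz_operator F \<longleftrightarrow>
     (\<exists>L>0. \<forall>u v w. blinfun_apply (F u - F v) w \<le> L * norm (u - v) * norm w)"

text \<open>
  Conditions (A1)--(A3) on a family of forms \<open>a u v w\<close>, standing for \<open>a(u; v, w)\<close>. The constants
  are uniform in \<open>u\<close>.
\<close>

definition uniformly_coercive :: "('a::real_normed_vector \<Rightarrow> 'a \<Rightarrow> 'a \<Rightarrow> real) \<Rightarrow> bool" where
  "uniformly_coercive a \<longleftrightarrow> (\<exists>\<alpha>>0. \<forall>u v. a u v v \<ge> \<alpha> * (norm v)\<^sup>2)"

definition uniformly_bounded :: "('a::real_normed_vector \<Rightarrow> 'a \<Rightarrow> 'a \<Rightarrow> real) \<Rightarrow> bool" where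
  "uniformly_bounded a \<longleftrightarrow> (\<exists>\<beta>>0. \<forall>u v w. a u v w \<le> \<beta> * norm v * norm w)"

definition symmetric_forms :: "('a \<Rightarrow> 'a \<Rightarrow> 'a \<Rightarrow> real) \<Rightarrow> bool" where
  "symmetric_forms a \<longleftrightarrow> (\<forall>u v w. a u v w = a u w v)"

definition forms_of_operators ::
    "('a::real_normed_vector \<Rightarrow> 'a \<Rightarrow> 'a \<Rightarrow>\<^sub>L real) \<Rightarrow> 'a \<Rightarrow> 'a \<Rightarrow> 'a \<Rightarrow> real" where
  "forms_of_operators P u v w = blinfun_apply (P u v) w"

text \<open>
  \<open>Blinfun\<close> is only meaningful on bounded linear maps; \<open>a u v\<close> is one when \<open>a u\<close> is bilinear
  and (A2) holds.
\<close>

definition operators_of_forms ::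
    "('a::real_normed_vector \<Rightarrow> 'a \<Rightarrow> 'a \<Rightarrow> real) \<Rightarrow> 'a \<Rightarrow> 'a \<Rightarrow> 'a \<Rightarrow>\<^sub>L real" where
  "operators_of_forms a u v = Blinfun (a u v)"

definition is_gradient ::
    "('a::real_normed_vector \<Rightarrow> 'a \<Rightarrow> real) \<Rightarrow> ('a \<Rightarrow> real) \<Rightarrow> 'a \<Rightarrow> 'a \<Rightarrow> bool" where
  "is_gradient b H u g \<longleftrightarrow> (\<forall>v. b g v = blinfun_apply (gateaux_deriv H u) v)"

definition gradient ::
    "('a::real_normed_vector \<Rightarrow> 'a \<Rightarrow> real) \<Rightarrow> ('a \<Rightarrow> real) \<Rightarrow> 'a \<Rightarrow> 'a" where
  "gradient b H u = (THE g. is_gradient b H u g)"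

primrec preconditioned_iteration ::
    "('a::real_normed_vector \<Rightarrow> 'a \<Rightarrow> 'a \<Rightarrow>\<^sub>L real) \<Rightarrow> ('a \<Rightarrow> 'a \<Rightarrow>\<^sub>L real) \<Rightarrow> 'a \<Rightarrow> nat \<Rightarrow> 'a" where
  "preconditioned_iteration P F u0 0 = u0"
| "preconditioned_iteration P F u0 (Suc n) =
     (let u = preconditioned_iteration P F u0 n in u - inv (P u) (F u))"

primrec steepest_descent ::
    "('a::real_normed_vector \<Rightarrow> 'a \<Rightarrow> 'a \<Rightarrow> real) \<Rightarrow> ('a \<Rightarrow> real) \<Rightarrow> (nat \<Rightarrow> real) \<Rightarrow> 'a \<Rightarrow> nat \<Rightarrow> 'a" where
  "steepest_descent a H \<delta> u0 0 = u0"
| "steepest_descent a H \<delta> u0 (Suc n) =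
     (let u = steepest_descent a H \<delta> u0 n in u - \<delta> n *\<^sub>R gradient (a u) H u)"

end

theory Submission
  imports Defs
begin

text \<open>
  The defining equation of the gradient with respect to \<open>a\<^sub>u\<close> reads \<open>P[u] g = H'(u)\<close>, so
  the gradient is \<open>P[u]\<^sup>-\<^sup>1 F(u)\<close> and the two iterations take the same steps. In (ii) the
  bijectivity of \<open>P[u]\<close> is the Lax--Milgram theorem for symmetric forms: a solution of
  \<open>b(g, v) = f(v)\<close> for all \<open>v\<close> is the minimizer of the energy \<open>b(v, v) - 2 f(v)\<close>, whose
  minimizing sequences are Cauchy by the parallelogram law and coercivity.
\<close>

text \<open>Near \<open>t = 0\<close> a nonzero linear term outweighs the quadratic one and takes
  both signs. This serves as the first-order condition at a minimizer.\<close>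

lemma linear_coeff_eq_0_of_quadratic_nonneg:
  fixes c d :: real
  assumes "d \<ge> 0" "\<And>t. t\<^sup>2 * d + 2 * t * c \<ge> 0"
  shows "c = 0"
proof (rule ccontr)
  assume "c \<noteq> 0"
  \<comment> \<open>The denominator \<open>d + 1\<close> also covers \<open>d = 0\<close>; with this
    \<open>t\<close> the quadratic equals \<open>- (t\<^sup>2 * (d + 2))\<close>.\<close>
  define t where "t = - c / (d + 1)"
  have c: "c = - (t * (d + 1))" and "t \<noteq> 0"
    using \<open>d \<ge> 0\<close> \<open>c \<noteq> 0\<close> by (simp_all add: t_def add_nonneg_eq_0_iff)
  have "0 \<le> t\<^sup>2 * d + 2 * t * c"
    by (rule assms(2))
  also have "\<dots> = - (t\<^sup>2 * (d + 2))"
    by (simp add: c algebra_simps power2_eq_square)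
  also have "\<dots> < 0"
    using \<open>d \<ge> 0\<close> \<open>t \<noteq> 0\<close> by (simp add: mult_pos_pos)
  finally show False by simp
qed

text \<open>Stated for complete normed spaces: the form \<open>b\<close> itself plays the part of
  the inner product, and completeness supplies the limit of a minimizing sequence.\<close>

lemma symmetric_lax_milgram:
  fixes b :: "'a::{real_normed_vector,complete_space} \<Rightarrow> 'a \<Rightarrow> real" and f :: "'a \<Rightarrow>\<^sub>L real"
  assumes "bounded_bilinear b"
    and \<alpha>: "\<alpha> > 0" "\<And>v. b v v \<ge> \<alpha> * (norm v)\<^sup>2"
    and sym: "\<And>v w. b v w = b w v"
  shows "\<exists>g. \<forall>v. b g v = blinfun_apply f v"
proof -
  interpret b: bounded_bilinear b by fact
  define J where "J v = b v v - 2 * blinfun_apply f v" for v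
  \<comment> \<open>Complete the square in \<open>norm v\<close>, so that the infimum of
    \<open>J\<close> is finite.\<close>
  have J_lower: "- ((norm f)\<^sup>2 / \<alpha>) \<le> J v" for v
  proof -
    have "0 \<le> (\<alpha> * norm v - norm f)\<^sup>2 / \<alpha>"
      using \<alpha>(1) by simp
    also have "\<dots> = \<alpha> * (norm v)\<^sup>2 - 2 * (norm f * norm v) + (norm f)\<^sup>2 / \<alpha>"
      using \<alpha>(1) by (simp add: field_simps power2_eq_square)
    finally have "- ((norm f)\<^sup>2 / \<alpha>) \<le> \<alpha> * (norm v)\<^sup>2 - 2 * (norm f * norm v)"
      by simp
    also have "\<dots> \<le> J v"
      using \<alpha>(2)[of v] norm_blinfun[of f v] by (simp add: J_def abs_le_iff)
    finally show ?thesis .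
  qed
  then have bdd: "bdd_below (range J)"
    by (auto intro!: bdd_belowI)
  define m where "m = Inf (range J)"
  have m_le: "m \<le> J v" for v
    unfolding m_def using bdd by (simp add: cInf_lower)
  have "\<exists>v. J v < m + 1 / real (Suc n)" for n
    using cInf_lessD[of "range J" "m + 1 / real (Suc n)"] by (auto simp: m_def)
  then obtain x where x: "\<And>n. J (x n) < m + 1 / real (Suc n)"
    by metis
  \<comment> \<open>The parallelogram law of \<open>b\<close> carries over to \<open>J\<close>
    because the terms in \<open>f\<close> agree on both sides.\<close>
  have parallelogram: "J v + J w = 2 * J ((1/2) *\<^sub>R (v + w)) + (1/2) * b (v - w) (v - w)" for v w
    by (simp add: J_def b.add_left b.add_right b.diff_left b.diff_right b.scaleR_left b.scaleR_right
        blinfun.add_right blinfun.scaleR_right algebra_simps)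
  \<comment> \<open>The midpoint \<open>z\<close> has energy at least \<open>m\<close>, so two
    points of nearly minimal energy must be close.\<close>
  have dist_le: "\<alpha> * (norm (v - w))\<^sup>2 \<le> 2 * (J v + J w - 2 * m)" for v w
  proof -
    define z where "z = (1/2) *\<^sub>R (v + w)"
    show ?thesis
      using parallelogram[of v w, folded z_def] m_le[of z] \<alpha>(2)[of "v - w"] by argo
  qed
  have "Cauchy x"
  proof (rule CauchyI)
    fix e :: real assume "e > 0"
    \<comment> \<open>From \<open>N\<close> on, each energy exceeds \<open>m\<close> by less than
      \<open>1 / (N + 1)\<close>, so \<open>dist_le\<close> gives the bound
      \<open>4 / (N + 1)\<close>, which has to stay below
      \<open>\<alpha> * e\<^sup>2\<close>.\<close>
    obtain N where N: "4 / (\<alpha> * e\<^sup>2) < real N"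
      using reals_Archimedean2 by blast
    have "norm (x i - x j) < e" if "N \<le> i" "N \<le> j" for i j
    proof -
      have le: "J (x k) < m + 1 / real (Suc N)" if "N \<le> k" for k
      proof -
        have "1 / real (Suc k) \<le> 1 / real (Suc N)"
          using that by (simp add: frac_le)
        then show ?thesis using x[of k] by linarith
      qed
      have "\<alpha> * (norm (x i - x j))\<^sup>2 < 4 * (1 / real (Suc N))"
        using dist_le[of "x i" "x j"] le[OF \<open>N \<le> i\<close>] le[OF \<open>N \<le> j\<close>] by argo
      also have "\<dots> < \<alpha> * e\<^sup>2"
        using N \<alpha>(1) \<open>e > 0\<close> by (auto simp: field_simps intro: order_less_trans)
      finally show ?thesis
        using \<alpha>(1) \<open>e > 0\<close> by (simp add: power_less_imp_less_base)
    qed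
    then show "\<exists>N. \<forall>i\<ge>N. \<forall>j\<ge>N. norm (x i - x j) < e" by blast
  qed
  then obtain g where g: "x \<longlonglongrightarrow> g"
    using Cauchy_convergent convergent_def by blast
  \<comment> \<open>Continuity of \<open>J\<close> passes the bounds on \<open>J (x n)\<close> to
    the limit, so \<open>g\<close> attains the infimum.\<close>
  have "(\<lambda>n. J (x n)) \<longlonglongrightarrow> J g"
    unfolding J_def by (intro tendsto_intros b.tendsto g)
  moreover have "(\<lambda>n. m + 1 / real (Suc n)) \<longlonglongrightarrow> m + 0"
    by (intro tendsto_intros LIMSEQ_Suc[OF lim_1_over_n])
  ultimately have "J g \<le> m + 0"
    using x by (intro LIMSEQ_le) (auto intro: less_imp_le)
  then have min: "J g \<le> J v" for v
    using m_le[of v] by simp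
  have "b g v = blinfun_apply f v" for v
  proof -
    have "b g v - blinfun_apply f v = 0"
    proof (rule linear_coeff_eq_0_of_quadratic_nonneg)
      show "0 \<le> b v v"
        using \<alpha>(1) \<alpha>(2)[of v] by (meson less_imp_le mult_nonneg_nonneg order_trans zero_le_power2)
      \<comment> \<open>The right-hand side is \<open>J (g + t *\<^sub>R v) - J g\<close>; symmetry
        merges the cross terms \<open>b g v\<close> and \<open>b v g\<close>.\<close>
      show "0 \<le> t\<^sup>2 * b v v + 2 * t * (b g v - blinfun_apply f v)" for t
        using min[of "g + t *\<^sub>R v"] sym[of v g]
        by (simp add: J_def b.add_left b.add_right b.scaleR_left b.scaleR_right
            blinfun.add_right blinfun.scaleR_right algebra_simps power2_eq_square)
    qed
    then show ?thesis by simp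
  qed
  then show ?thesis by blast
qed

text \<open>(A2) bounds the form only from above; applying it to \<open>- w\<close> as well bounds
  the absolute value.\<close>

lemma bounded_bilinear_of_one_sided_bound:
  fixes b :: "'a::real_normed_vector \<Rightarrow> 'a \<Rightarrow> real"
  assumes "bilinear b" and bound: "\<And>v w. b v w \<le> \<beta> * norm v * norm w"
  shows "bounded_bilinear b"
proof
  show "\<exists>K. \<forall>v w. norm (b v w) \<le> norm v * norm w * K"
  proof (intro exI allI)
    fix v w
    show "norm (b v w) \<le> norm v * norm w * \<beta>"
      using bound[of v w] bound[of v "- w"] bilinear_rneg[OF assms(1), of v w]
      by (simp add: abs_le_iff mult.commute mult.left_commute)
  qed
qed (simp_all add: bilinear_ladd bilinear_radd bilinear_lmul bilinear_rmul assms(1))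

text \<open>Functionals agreeing on every vector are equal, so the gradient identity is an operator
  equation. The equivalence yields existence and uniqueness at once and evaluates the
  \<open>THE\<close> in \<open>gradient\<close>.\<close>

lemma is_gradient_forms_of_operators_iff:
  assumes "bij (P u)"
  shows "is_gradient (forms_of_operators P u) H u g \<longleftrightarrow> g = inv (P u) (gateaux_deriv H u)"
proof -
  have "is_gradient (forms_of_operators P u) H u g \<longleftrightarrow> P u g = gateaux_deriv H u"
    by (auto simp: is_gradient_def forms_of_operators_def intro: blinfun_eqI)
  then show ?thesis
    using assms by (metis bij_inv_eq_iff)
qed

text \<open>Both (i) and (ii) reduce to this lemma once the operators are known to be
  bijective.\<close>

lemma preconditioned_iteration_eq_steepest_descent:
  assumes "\<And>u. bij (P u)"
  shows "preconditioned_iteration P (gateaux_deriv H) u0 =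
         steepest_descent (forms_of_operators P) H (\<lambda>n. 1) u0"
proof
  have "gradient (forms_of_operators P u) H u = inv (P u) (gateaux_deriv H u)" for u
    by (simp add: gradient_def is_gradient_forms_of_operators_iff assms)
  then show "preconditioned_iteration P (gateaux_deriv H) u0 n =
      steepest_descent (forms_of_operators P) H (\<lambda>n. 1) u0 n" for n
    by (induction n) (simp_all add: Let_def)
qed

lemma operators_of_forms_apply:
  assumes "bounded_bilinear (a u)"
  shows "blinfun_apply (operators_of_forms a u v) w = a u v w"
  by (simp add: operators_of_forms_def bounded_linear_Blinfun_apply
      bounded_bilinear.bounded_linear_right[OF assms])

lemma linear_operators_of_forms:
  assumes "bounded_bilinear (a u)"
  shows "linear (operators_of_forms a u)"
  by (intro linearI blinfun_eqI)
    (simp_all add: operators_of_forms_apply[where a = a, OF assms] blinfun.add_left blinfun.scaleR_left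
      bounded_bilinear.add_left[OF assms] bounded_bilinear.scaleR_left[OF assms])

text \<open>Testing a kernel element \<open>v\<close> against itself, coercivity forces
  \<open>v = 0\<close>; surjectivity is Lax--Milgram.\<close>

lemma bij_operators_of_forms:
  fixes a :: "'a::{real_normed_vector,complete_space} \<Rightarrow> 'a \<Rightarrow> 'a \<Rightarrow> real"
  assumes bdd: "bounded_bilinear (a u)"
    and \<alpha>: "\<alpha> > 0" "\<And>v. a u v v \<ge> \<alpha> * (norm v)\<^sup>2"
    and sym: "\<And>v w. a u v w = a u w v"
  shows "bij (operators_of_forms a u)"
proof (rule bijI)
  have "v = 0" if "operators_of_forms a u v = 0" for v
  proof -
    have "a u v v = 0"
      using operators_of_forms_apply[where a = a, OF bdd, of v v] that by simp
    then show ?thesis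
      using \<alpha>(1) \<alpha>(2)[of v] by (simp add: mult_le_0_iff)
  qed
  then show "inj (operators_of_forms a u)"
    using linear_injective_0[OF linear_operators_of_forms[where a = a, OF bdd]] by blast
  show "surj (operators_of_forms a u)"
  proof (rule surjI)
    fix f
    have "\<exists>g. \<forall>v. a u g v = blinfun_apply f v"
      by (rule symmetric_lax_milgram[where b = "a u", OF bdd \<alpha> sym])
    then have "\<exists>g. operators_of_forms a u g = f"
      by (metis blinfun_eqI operators_of_forms_apply[where a = a, OF bdd])
    then show "operators_of_forms a u (SOME g. operators_of_forms a u g = f) = f"
      by (rule someI_ex)
  qed
qed

theorem proposition2p1:
  fixes H :: "'a::{real_inner,complete_space} \<Rightarrow> real"
    and F :: "'a \<Rightarrow> 'a \<Rightarrow>\<^sub>L real"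
  assumes "gateaux_differentiable H"
    and "strictly_convex H"
    and "weakly_coercive H"
    and "F = gateaux_deriv H"
    and "strongly_monotone F"
    and "lipschitz_operator F"
  shows
    "(\<forall>P :: 'a \<Rightarrow> 'a \<Rightarrow> 'a \<Rightarrow>\<^sub>L real.
        (\<forall>u. linear (P u) \<and> bij (P u)) \<longrightarrow>
        uniformly_coercive (forms_of_operators P) \<longrightarrow>
        uniformly_bounded (forms_of_operators P) \<longrightarrow>
        symmetric_forms (forms_of_operators P) \<longrightarrow>
        (\<forall>u. \<exists>!g. is_gradient (forms_of_operators P u) H u g) \<and>
        (\<forall>u0. preconditioned_iteration P F u0 =
              steepest_descent (forms_of_operators P) H (\<lambda>n. 1) u0)) \<and>
     (\<forall>a :: 'a \<Rightarrow> 'a \<Rightarrow> 'a \<Rightarrow> real.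
        (\<forall>u. bilinear (a u)) \<longrightarrow>
        uniformly_coercive a \<longrightarrow>
        uniformly_bounded a \<longrightarrow>
        symmetric_forms a \<longrightarrow>
        (\<forall>u v w. blinfun_apply (operators_of_forms a u v) w = a u v w) \<and>
        (\<forall>u. linear (operators_of_forms a u) \<and> bij (operators_of_forms a u)) \<and>
        (\<forall>u. \<exists>!g. is_gradient (a u) H u g) \<and>
        (\<forall>u0. preconditioned_iteration (operators_of_forms a) F u0 =
              steepest_descent a H (\<lambda>n. 1) u0))"
proof (rule conjI; intro allI impI)
  fix P :: "'a \<Rightarrow> 'a \<Rightarrow> 'a \<Rightarrow>\<^sub>L real"
  assume "\<forall>u. linear (P u) \<and> bij (P u)"
  then have bij: "bij (P u)" for u by blast
  show "(\<forall>u. \<exists>!g. is_gradient (forms_of_operators P u) H u g) \<and>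
      (\<forall>u0. preconditioned_iteration P F u0 =
            steepest_descent (forms_of_operators P) H (\<lambda>n. 1) u0)"
    using bij by (simp add: is_gradient_forms_of_operators_iff \<open>F = gateaux_deriv H\<close>
        preconditioned_iteration_eq_steepest_descent)
next
  fix a :: "'a \<Rightarrow> 'a \<Rightarrow> 'a \<Rightarrow> real"
  assume bil: "\<forall>u. bilinear (a u)" and "uniformly_coercive a" "uniformly_bounded a"
    and sym: "symmetric_forms a"
  then obtain \<alpha> \<beta> where \<alpha>: "\<alpha> > 0" "\<And>u v. a u v v \<ge> \<alpha> * (norm v)\<^sup>2"
    and \<beta>: "\<And>u v w. a u v w \<le> \<beta> * norm v * norm w"
    unfolding uniformly_coercive_def uniformly_bounded_def by blast
  have bdd: "bounded_bilinear (a u)" for u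
    using bil \<beta> by (blast intro: bounded_bilinear_of_one_sided_bound)
  have bij: "bij (operators_of_forms a u)" for u
    using bij_operators_of_forms[of a, OF bdd \<alpha>] sym by (simp add: symmetric_forms_def)
  \<comment> \<open>Passing from forms to operators and back changes nothing, so the results for
    operator families apply to \<open>a\<close>.\<close>
  have forms: "forms_of_operators (operators_of_forms a) = a"
    by (intro ext) (simp add: forms_of_operators_def operators_of_forms_apply bdd)
  show "(\<forall>u v w. blinfun_apply (operators_of_forms a u v) w = a u v w) \<and>
      (\<forall>u. linear (operators_of_forms a u) \<and> bij (operators_of_forms a u)) \<and>
      (\<forall>u. \<exists>!g. is_gradient (a u) H u g) \<and>
      (\<forall>u0. preconditioned_iteration (operators_of_forms a) F u0 =
            steepest_descent a H (\<lambda>n. 1) u0)"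
    using is_gradient_forms_of_operators_iff[of "operators_of_forms a", OF bij]
      preconditioned_iteration_eq_steepest_descent[of "operators_of_forms a", OF bij]
    by (simp add: forms operators_of_forms_apply linear_operators_of_forms bdd bij
        \<open>F = gateaux_deriv H\<close>)
qed

end
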